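(* Let $n\ge 3$ and let $F$ be a field of characteristic $\ne 2$. Let $L=L_{n+1}$ be the simple $(n+1)$-dimensional $n$-Lie algebra over $F$ with basis $e_1,\dots,e_{n+1}$ and $[e_1,\dots,\widehat{e}_i,\dots,e_{n+1}]=(-1)^{n+i+1}e_i$ for $1\le i\le n+1$. Let $G_1,\dots,G_{n+1}\in F\langle x_1,\dots,x_{n+1}\rangle$ be the elements $$G_i=(-1)^{\lfloor n/2\rfloor}\big(\mathrm{alt}(x_1,\dots,\widehat{x}_i,\dots,x_{n+1})-(-1)^{n+i+1}x_i\big).$$ Then $\{G_1,\dots,G_{n+1}\}$ is a Gröbner basis (with respect to the degree-lexicographical order) of the two-sided ideal $I=\langle G_1,\dots,G_{n+1}\rangle$ of the free associative algebra $F\langle x_1,\dots,x_{n+1}\rangle$ if and only if $n$ is even.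
   Context: An $n$-Lie algebra is a vector space over a field of characteristic $\neq2$ with a multilinear alternating operation $[z_1,\dots,z_n]$ (permuting arguments by $\sigma$ multiplies by the sign $\epsilon(\sigma)$) satisfying $[[z_1,\dots,z_n],w_2,\dots,w_n]=\sum_{i=1}^n[z_1,\dots,[z_i,w_2,\dots,w_n],\dots,z_n]$. A hat means the entry is omitted. $\mathrm{alt}(z_1,\dots,z_n)=\sum_{\sigma\in S_n}\epsilon(\sigma)z_{\sigma(1)}\cdots z_{\sigma(n)}$. $F\langle X\rangle$, $X=\{x_1,\dots,x_{n+1}\}$, is the free unital associative algebra, with basis the words $X^*$. Degree-lexicographical order on words: $u<v$ iff $\deg u<\deg v$, or $\deg u=\deg v$ and at the first position where they differ $u$ has $x_i$ and $v$ has $x_j$ with $i<j$. $\mathrm{LM}(f)$ is the largest word occurring with nonzero coefficient in $f\ne0$. A word $u$ is a factor of $v$ if $v=w_1uw_2$ for some (possibly empty) words $w_1,w_2$. A subset $G$ of an ideal $I$ is a Gröbner basis of $I$ if for every nonzero $f\in I$ there is $g\in G$ such that $\mathrm{LM}(g)$ is a factor of $\mathrm{LM}(f)$. *)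

theory Defs
  imports
    Complex_Main
    "HOL-Library.Poly_Mapping"
    "HOL-Combinatorics.Permutations"
    "HOL-Algebra.Ideal"
begin

section \<open>n-Lie algebras\<close>

text \<open>
  The underlying space is a subspace \<open>L\<close> of an arbitrary \<open>'a\<close>-vector space, so that the dimension of
  \<open>L\<close> can be a variable natural number.  The bracket takes the list of its arguments; it is
  constrained only on lists of length \<open>n\<close> with entries in \<open>L\<close>.
\<close>

locale n_Lie_algebra = vector_space scale
  for scale :: "'a::field \<Rightarrow> 'v::ab_group_add \<Rightarrow> 'v" +
  fixes n :: nat and L :: "'v set" and br :: "'v list \<Rightarrow> 'v"
  assumes char_ne_2: "(2::'a) \<noteq> 0"
    and subspace_L: "subspace L"
    and br_closed: "length zs = n \<Longrightarrow> set zs \<subseteq> L \<Longrightarrow> br zs \<in> L"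
    and br_add: "length zs = n \<Longrightarrow> set zs \<subseteq> L \<Longrightarrow> i < n \<Longrightarrow> x \<in> L \<Longrightarrow> y \<in> L \<Longrightarrow>
      br (zs[i := x + y]) = br (zs[i := x]) + br (zs[i := y])"
    and br_scale: "length zs = n \<Longrightarrow> set zs \<subseteq> L \<Longrightarrow> i < n \<Longrightarrow> x \<in> L \<Longrightarrow>
      br (zs[i := scale c x]) = scale c (br (zs[i := x]))"
    and br_permute: "length zs = n \<Longrightarrow> set zs \<subseteq> L \<Longrightarrow> \<sigma> permutes {..<n} \<Longrightarrow>
      br (permute_list \<sigma> zs) = scale (of_int (sign \<sigma>)) (br zs)"
    and br_derivation: "length zs = n \<Longrightarrow> set zs \<subseteq> L \<Longrightarrow>
      length ws = n - 1 \<Longrightarrow> set ws \<subseteq> L \<Longrightarrow>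
      br (br zs # ws) = (\<Sum>i<n. br (zs[i := br (zs ! i # ws)]))"
begin

definition n_Lie_ideal :: "'v set \<Rightarrow> bool" where
  "n_Lie_ideal J \<longleftrightarrow> subspace J \<and> J \<subseteq> L \<and>
     (\<forall>zs. length zs = n \<and> set zs \<subseteq> L \<and> set zs \<inter> J \<noteq> {} \<longrightarrow> br zs \<in> J)"

definition simple :: bool where
  "simple \<longleftrightarrow> (\<exists>zs. length zs = n \<and> set zs \<subseteq> L \<and> br zs \<noteq> 0) \<and>
     (\<forall>J. n_Lie_ideal J \<longrightarrow> J = {0} \<or> J = L)"

end

text \<open>The list \<open>z\<^sub>1, \<dots>, z\<^sub>n\<^sub>+\<^sub>1\<close> with the entry \<open>z\<^sub>i\<close> omitted.\<close>

definition omit :: "nat \<Rightarrow> nat \<Rightarrow> (nat \<Rightarrow> 'b) \<Rightarrow> 'b list" where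
  "omit n i z = map z (filter (\<lambda>j. j \<noteq> i) [1..<n + 2])"


section \<open>The free associative algebra\<close>

text \<open>
  Words form a monoid under concatenation, written additively because multiplication of
  \<^typ>\<open>'k::monoid_add \<Rightarrow>\<^sub>0 'a::semiring_0\<close> is convolution along \<open>+\<close>.  So the type \<open>word \<Rightarrow>\<^sub>0 'a\<close> is the
  free unital associative algebra on letters indexed by all natural numbers; \<open>free_algebra n\<close> below
  is the subalgebra on the letters with indices \<open>1, \<dots>, n + 1\<close>.
\<close>

datatype word = Word (letters: "nat list")

instantiation word :: monoid_add
begin

definition zero_word :: word where
  "0 = Word []"

definition plus_word :: "word \<Rightarrow> word \<Rightarrow> word" where
  "u + v = Word (letters u @ letters v)"

instance
  by standard (simp_all add: zero_word_def plus_word_def)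

end

text \<open>The degree-lexicographical order: \<open>lenlex\<close> compares lengths first.\<close>

instantiation word :: linorder
begin

definition less_word :: "word \<Rightarrow> word \<Rightarrow> bool" where
  "u < v \<longleftrightarrow> (letters u, letters v) \<in> lenlex {(i, j). i < j}"

definition less_eq_word :: "word \<Rightarrow> word \<Rightarrow> bool" where
  "u \<le> v \<longleftrightarrow> u < v \<or> u = (v::word)"

instance
proof
  have trans: "trans (lenlex {(i::nat, j). i < j})"
    by (rule lenlex_transI) (auto simp: trans_def)
  have irrefl: "(xs, xs) \<notin> lenlex {(i::nat, j). i < j}" for xs
    by (rule lenlex_irreflexive) auto
  have total: "total (lenlex {(i::nat, j). i < j})"
    by (rule total_lenlex) (auto simp: total_on_def)
  fix u v w :: word
  show "u < v \<longleftrightarrow> u \<le> v \<and> \<not> v \<le> u"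
    unfolding less_eq_word_def less_word_def using transD[OF trans] irrefl by blast
  show "u \<le> u"
    by (simp add: less_eq_word_def)
  show "u \<le> v \<Longrightarrow> v \<le> w \<Longrightarrow> u \<le> w"
    unfolding less_eq_word_def less_word_def using transD[OF trans] by blast
  show "u \<le> v \<Longrightarrow> v \<le> u \<Longrightarrow> u = v"
    unfolding less_eq_word_def less_word_def using transD[OF trans] irrefl by blast
  show "u \<le> v \<or> v \<le> u"
    using total unfolding less_eq_word_def less_word_def total_on_def
    by (metis UNIV_I word.expand)
qed

end

definition free_algebra :: "nat \<Rightarrow> (word \<Rightarrow>\<^sub>0 'a::field) ring" where
  "free_algebra n = \<lparr>carrier = {f. \<forall>w \<in> Poly_Mapping.keys f. set (letters w) \<subseteq> {1..n + 1}},
     monoid.mult = (*), one = 1, ring.zero = 0, add = (+)\<rparr>"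

lemma ring_free_algebra: "ring (free_algebra n :: (word \<Rightarrow>\<^sub>0 'a::field) ring)"
    (is "ring ?R")
proof -
  have mult: "f * g \<in> carrier ?R" if "f \<in> carrier ?R" "g \<in> carrier ?R" for f g
    using that keys_mult[of f g] by (fastforce simp: free_algebra_def plus_word_def)
  have add: "f + g \<in> carrier ?R" if "f \<in> carrier ?R" "g \<in> carrier ?R" for f g
    using that Poly_Mapping.keys_add[of f g] by (fastforce simp: free_algebra_def)
  have neg: "- f \<in> carrier ?R \<and> - f + f = 0" if "f \<in> carrier ?R" for f
    using that by (simp add: free_algebra_def)
  have one: "1 \<in> carrier ?R" and zero: "0 \<in> carrier ?R"
    by (auto simp: free_algebra_def zero_word_def)
  have ops: "x \<otimes>\<^bsub>?R\<^esub> y = x * y" "x \<oplus>\<^bsub>?R\<^esub> y = x + y" "\<one>\<^bsub>?R\<^esub> = 1" "\<zero>\<^bsub>?R\<^esub> = 0" for x y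
    by (simp_all add: free_algebra_def)
  show ?thesis
  proof (intro ringI abelian_groupI monoidI)
    show "\<exists>y\<in>carrier ?R. y \<oplus>\<^bsub>?R\<^esub> x = \<zero>\<^bsub>?R\<^esub>" if "x \<in> carrier ?R" for x
      using neg[OF that] unfolding ops by blast
  qed (simp_all only: ops mult add one zero add.assoc add.commute add.left_commute mult.assoc
        distrib_left distrib_right add_0_left add_0_right mult_1_left mult_1_right)
qed

definition var :: "nat \<Rightarrow> (word \<Rightarrow>\<^sub>0 'a::field)" where
  "var i = Poly_Mapping.single (Word [i]) 1"

definition alt :: "'r::ring_1 list \<Rightarrow> 'r" where
  "alt zs = (\<Sum>\<sigma> | \<sigma> permutes {..<length zs}. of_int (sign \<sigma>) * prod_list (permute_list \<sigma> zs))"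

definition G :: "nat \<Rightarrow> nat \<Rightarrow> (word \<Rightarrow>\<^sub>0 'a::field)" where
  "G n i = (-1) ^ (n div 2) * (alt (omit n i var) - (-1) ^ (n + i + 1) * var i)"


section \<open>Groebner bases\<close>

definition LM :: "(word \<Rightarrow>\<^sub>0 'a::field) \<Rightarrow> word" where
  "LM f = Max (Poly_Mapping.keys f)"

definition factor :: "word \<Rightarrow> word \<Rightarrow> bool" where
  "factor u v \<longleftrightarrow> (\<exists>w\<^sub>1 w\<^sub>2. v = w\<^sub>1 + u + w\<^sub>2)"

text \<open>\<open>LM 0\<close> is unspecified, hence the condition \<open>g \<noteq> 0\<close>.\<close>

definition groebner_basis :: "(word \<Rightarrow>\<^sub>0 'a::field) set \<Rightarrow> (word \<Rightarrow>\<^sub>0 'a) set \<Rightarrow> bool" where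
  "groebner_basis B I \<longleftrightarrow> B \<subseteq> I \<and>
     (\<forall>f \<in> I. f \<noteq> 0 \<longrightarrow> (\<exists>g \<in> B. g \<noteq> 0 \<and> factor (LM g) (LM f)))"

end

theory Submission
  imports Defs
begin

text \<open>
  The leading word of \<open>G\<^sub>i\<close> is the decreasing word \<open>m\<^sub>i\<close> in all letters except \<open>x\<^sub>i\<close>, of length \<open>n\<close>,
  and the sign in front makes \<open>G\<^sub>i\<close> monic (\<open>LM_G\<close>, \<open>lookup_G\<close>).  Decreasing words overlap in very few
  ways: the only overlap of \<open>m\<^sub>1, \<dots>, m\<^sub>n\<^sub>+\<^sub>1\<close> is that of \<open>m\<^sub>1 = x\<^sub>n\<^sub>+\<^sub>1 \<dots> x\<^sub>2\<close> with
  \<open>m\<^sub>n\<^sub>+\<^sub>1 = x\<^sub>n \<dots> x\<^sub>1\<close> in the word \<open>x\<^sub>n\<^sub>+\<^sub>1 x\<^sub>n \<dots> x\<^sub>1\<close> (\<open>unique_overlap\<close>).  So by the diamond lemma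
  everything depends on the one composition \<open>G\<^sub>1 x\<^sub>1 - x\<^sub>n\<^sub>+\<^sub>1 G\<^sub>n\<^sub>+\<^sub>1\<close>.

  It is controlled by expanding \<open>alt(x\<^sub>1, \<dots>, x\<^sub>n\<^sub>+\<^sub>1)\<close> along the first and along the last factors of its
  products.  Comparing the two expansions gives a relation (\<open>relation_between_relations\<close>)

    \<open>\<Sum>\<^sub>i (-1)\<^sup>i (x\<^sub>i G\<^sub>i - (-1)\<^sup>n G\<^sub>i x\<^sub>i) = \<plusminus> (1 - (-1)\<^sup>n) \<Sum>\<^sub>i x\<^sub>i\<^sup>2\<close>.

  For even \<open>n\<close> the right-hand side is zero.  The relation then writes \<open>G\<^sub>1 x\<^sub>1 - x\<^sub>n\<^sub>+\<^sub>1 G\<^sub>n\<^sub>+\<^sub>1\<close> as a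
  combination of products \<open>x\<^sub>i G\<^sub>i\<close> and \<open>G\<^sub>i x\<^sub>i\<close> with leading words below \<open>x\<^sub>n\<^sub>+\<^sub>1 \<dots> x\<^sub>1\<close>, so the
  composition is resolved and the \<open>G\<^sub>i\<close> form a Groebner basis.

  For odd \<open>n\<close> the relation shows that \<open>2 \<Sum>\<^sub>i x\<^sub>i\<^sup>2\<close> lies in the ideal.  As \<open>2 \<noteq> 0\<close>, it is a nonzero
  element whose leading word has length \<open>2\<close>, too short to contain a word \<open>m\<^sub>i\<close> of length \<open>n \<ge> 3\<close>.
\<close>

section \<open>Words\<close>

lemma letters_plus [simp]: "letters (u + v) = letters u @ letters v"
  by (simp add: plus_word_def)

lemma letters_zero [simp]: "letters 0 = []"
  by (simp add: zero_word_def)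

lemma word_add_left_cancel [simp]: "u + v = u + w \<longleftrightarrow> v = w" for u v w :: word
  by (metis letters_plus same_append_eq word.expand)

lemma word_add_mono: "u + v + w < u + v' + w" if "v < v'" for u v w :: word
proof -
  have irr: "irrefl {(i::nat, j). i < j}"
    by (auto simp: irrefl_def)
  have "(letters v @ letters w, letters v' @ letters w) \<in> lenlex {(i, j). i < j}"
    using that by (intro lenlex_append1) (simp_all add: less_word_def)
  then show ?thesis
    using irr by (simp add: less_word_def)
qed

lemma wf_word_less: "wf {(u::word, v). u < v}"
proof -
  have "wf (inv_image (lenlex {(i::nat, j). i < j}) letters)"
    by (intro wf_inv_image wf_lenlex wf)
  then show ?thesis
    by (simp add: less_word_def inv_image_def)
qed

text \<open>
  Levi's lemma.  It reduces the comparison of two occurrences of leading words in one word to a few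
  cases according to which is cut first.
\<close>

lemma word_add_eq_addE:
  fixes u v u' v' :: word
  assumes "u + v = u' + v'"
  obtains t where "u' = u + t" "v = t + v'" | t where "u = u' + t" "v' = t + v"
proof -
  have "letters u @ letters v = letters u' @ letters v'"
    using assms by (metis letters_plus)
  then obtain t where "letters u = letters u' @ t \<and> t @ letters v = letters v' \<or>
      letters u @ t = letters u' \<and> letters v = t @ letters v'"
    by (auto simp: append_eq_append_conv2)
  then have "u = u' + Word t \<and> v' = Word t + v \<or> u' = u + Word t \<and> v = Word t + v'"
    by (auto intro: word.expand)
  then show thesis
    using that by blast
qed


section \<open>Leading terms\<close>

abbreviation monomial :: "word \<Rightarrow> (word \<Rightarrow>\<^sub>0 'a::field)" where
  "monomial w \<equiv> Poly_Mapping.single w 1"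

lemma sum_monomials:
  fixes f :: "word \<Rightarrow>\<^sub>0 'a::field"
  shows "f = (\<Sum>w\<in>Poly_Mapping.keys f. Poly_Mapping.single w (Poly_Mapping.lookup f w))"
  by (rule poly_mapping_eqI) (simp add: lookup_sum lookup_single when_def in_keys_iff)

lemma keys_mult_word:
  fixes f h :: "word \<Rightarrow>\<^sub>0 'a::field"
  assumes "w \<in> Poly_Mapping.keys (f * h)"
  obtains u v where "u \<in> Poly_Mapping.keys f" "v \<in> Poly_Mapping.keys h" "w = u + v"
  using assms keys_mult[of f h] by blast

lemma scalar_commute:
  fixes f :: "word \<Rightarrow>\<^sub>0 'a::field"
  shows "Poly_Mapping.single 0 c * f = f * Poly_Mapping.single 0 c"
proof -
  let ?f = "\<Sum>w\<in>Poly_Mapping.keys f. Poly_Mapping.single w (Poly_Mapping.lookup f w)"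
  have "Poly_Mapping.single 0 c * ?f = ?f * Poly_Mapping.single 0 c"
    unfolding sum_distrib_left sum_distrib_right mult_single by (simp add: mult.commute)
  then show ?thesis
    by (simp only: sum_monomials[symmetric])
qed

lemma LM_in_keys: "f \<noteq> 0 \<Longrightarrow> LM f \<in> Poly_Mapping.keys f"
  by (simp add: LM_def Max_in)

lemma LM_ge: "w \<in> Poly_Mapping.keys f \<Longrightarrow> w \<le> LM f"
  by (simp add: LM_def)

lemma LM_eqI:
  assumes "Poly_Mapping.lookup f w \<noteq> 0" "\<And>v. v \<in> Poly_Mapping.keys f \<Longrightarrow> v \<le> w"
  shows "LM f = w"
  unfolding LM_def using assms by (intro Max_eqI) (auto simp: in_keys_iff)

text \<open>
  Meant for monic \<open>f\<close>, whence the coefficient \<open>1\<close> of the term that is taken off.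
\<close>

definition tail :: "(word \<Rightarrow>\<^sub>0 'a::field) \<Rightarrow> (word \<Rightarrow>\<^sub>0 'a)" where
  "tail f = f - monomial (LM f)"

definition monic :: "(word \<Rightarrow>\<^sub>0 'a::field) \<Rightarrow> bool" where
  "monic f \<longleftrightarrow> Poly_Mapping.lookup f (LM f) = 1"

lemma monic_nonzero: "monic f \<Longrightarrow> f \<noteq> 0"
  by (auto simp: monic_def)

lemma keys_tail:
  assumes "monic f" "w \<in> Poly_Mapping.keys (tail f)"
  shows "w < LM f"
proof -
  have ne: "w \<noteq> LM f"
    using assms by (auto simp: in_keys_iff tail_def lookup_minus monic_def)
  then have "w \<in> Poly_Mapping.keys f"
    using assms(2) by (auto simp: in_keys_iff tail_def lookup_minus lookup_single)
  then show ?thesis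
    using LM_ge[of w f] ne by simp
qed


section \<open>The diamond lemma\<close>

text \<open>
  The two-sided ideal generated by \<open>B\<close> is spanned by the translates \<open>u g v\<close> with \<open>u\<close>, \<open>v\<close> words and
  \<open>g \<in> B\<close>.  The set \<open>D\<close> restricts their leading words: the diamond lemma replaces all translates with
  a common leading word \<open>w\<close> by a single one, at the cost of translates with leading words below \<open>w\<close>.
\<close>

inductive_set translates :: "(word \<Rightarrow>\<^sub>0 'a::field) set \<Rightarrow> word set \<Rightarrow> (word \<Rightarrow>\<^sub>0 'a) set" for B D where
  zero: "0 \<in> translates B D"
| step: "f \<in> translates B D \<Longrightarrow> g \<in> B \<Longrightarrow> u + LM g + v \<in> D \<Longrightarrow>
    f + Poly_Mapping.single u a * g * monomial v \<in> translates B D"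

lemma translates_add:
  assumes "f \<in> translates B D" "h \<in> translates B D"
  shows "f + h \<in> translates B D"
  using assms(2)
proof induction
  case zero
  then show ?case using assms(1) by simp
next
  case (step h g u v a)
  then show ?case
    using translates.step[of "f + h"] by (simp add: add.assoc)
qed

lemma translates_sum:
  "(\<And>i. i \<in> A \<Longrightarrow> f i \<in> translates B D) \<Longrightarrow> sum f A \<in> translates B D"
  by (induction A rule: infinite_finite_induct) (auto intro: translates.zero translates_add)

lemma translates_mono:
  assumes "f \<in> translates B D" "D \<subseteq> D'"
  shows "f \<in> translates B D'"
  using assms(1)
  by induction (use assms(2) in \<open>auto intro!: translates.intros\<close>)

text \<open>
  Expanding \<open>p\<close> and \<open>q\<close> into monomials gives translates of \<open>g\<close>, as scalars are central.
\<close>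

lemma translates_mult_generator:
  assumes "g \<in> B"
    and D: "\<And>u v. u \<in> Poly_Mapping.keys p \<Longrightarrow> v \<in> Poly_Mapping.keys q \<Longrightarrow> u + LM g + v \<in> D"
  shows "p * g * q \<in> translates B D"
proof -
  let ?c = "Poly_Mapping.lookup"
  \<comment> \<open>The summand \<open>0\<close> brings the right-hand side into the form of the rule for \<open>translates\<close>.\<close>
  have single: "Poly_Mapping.single u a * g * Poly_Mapping.single v b =
      0 + Poly_Mapping.single u (a * b) * g * monomial v" for u v a b
  proof -
    have "Poly_Mapping.single u a * g * Poly_Mapping.single v b =
        Poly_Mapping.single u a * (g * Poly_Mapping.single 0 b) * monomial v"
      by (simp add: mult.assoc mult_single)
    also have "\<dots> = Poly_Mapping.single u (a * b) * g * monomial v"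
      by (simp add: scalar_commute[symmetric] mult.assoc[symmetric] mult_single mult.commute[of b])
    finally show ?thesis by simp
  qed
  let ?p = "\<Sum>u\<in>Poly_Mapping.keys p. Poly_Mapping.single u (?c p u)"
  let ?q = "\<Sum>v\<in>Poly_Mapping.keys q. Poly_Mapping.single v (?c q v)"
  have "?p * g * ?q = (\<Sum>u\<in>Poly_Mapping.keys p. \<Sum>v\<in>Poly_Mapping.keys q.
      Poly_Mapping.single u (?c p u) * g * Poly_Mapping.single v (?c q v))"
    unfolding sum_distrib_left sum_distrib_right by (rule sum.swap)
  also have "\<dots> \<in> translates B D"
    by (intro translates_sum, subst single) (intro translates.step translates.zero assms)
  finally show ?thesis
    by (simp only: sum_monomials[symmetric])
qed

lemma translates_uminus:
  assumes "f \<in> translates B D"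
  shows "- f \<in> translates B D"
  using assms
proof induction
  case zero
  then show ?case by (simp add: translates.zero)
next
  case (step f g u v a)
  then show ?case
    using translates.step[of "- f" B D g u v "- a"] by (simp add: single_uminus)
qed

lemma translates_diff:
  "f \<in> translates B D \<Longrightarrow> h \<in> translates B D \<Longrightarrow> f - h \<in> translates B D"
  using translates_add[of f B D "- h"] translates_uminus[of h] by simp

lemma translates_sign:
  "f \<in> translates B D \<Longrightarrow> (- 1) ^ k * f \<in> translates B D"
  by (cases "even k") (auto intro: translates_uminus)

lemma translates_mult:
  assumes "f \<in> translates B D"
    and D': "\<And>u v w. u \<in> Poly_Mapping.keys p \<Longrightarrow> v \<in> D \<Longrightarrow> w \<in> Poly_Mapping.keys q \<Longrightarrow> u + v + w \<in> D'"
  shows "p * f * q \<in> translates B D'"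
  using assms(1)
proof induction
  case zero
  then show ?case by (simp add: translates.zero)
next
  case (step f g u v a)
  have "(p * Poly_Mapping.single u a) * g * (monomial v * q) \<in> translates B D'"
  proof (rule translates_mult_generator)
    fix x y
    assume "x \<in> Poly_Mapping.keys (p * Poly_Mapping.single u a)"
      and "y \<in> Poly_Mapping.keys (monomial v * q)"
    then obtain x' y' where "x' \<in> Poly_Mapping.keys p" "x = x' + u"
        "y' \<in> Poly_Mapping.keys q" "y = v + y'"
      by (force elim!: keys_mult_word split: if_splits)
    then show "x + LM g + y \<in> D'"
      using D'[of x' "u + LM g + v" y'] step.hyps by (simp add: add.assoc)
  qed (fact step.hyps)
  from translates_add[OF step.IH this] show ?case
    by (simp add: algebra_simps)
qed

text \<open>Finitely many translates have a largest leading word.\<close>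

lemma translates_bounded:
  assumes "f \<in> translates B D"
  shows "f = 0 \<or> (\<exists>w\<in>D. f \<in> translates B {..w})"
  using assms
proof induction
  case zero
  then show ?case by simp
next
  case (step f g u v a)
  let ?x = "u + LM g + v"
  obtain w where w: "w \<in> D" "f \<in> translates B {..w}"
    using step.IH step.hyps translates.zero[of B "{..?x}"] by blast
  define z where "z = max w ?x"
  have "f \<in> translates B {..z}"
    using w(2) by (rule translates_mono) (auto simp: z_def)
  then have "f + Poly_Mapping.single u a * g * monomial v \<in> translates B {..z}"
    using step.hyps by (intro translates.step) (auto simp: z_def)
  moreover have "z \<in> D"
    using w(1) step.hyps by (simp add: z_def max_def)
  ultimately show ?case by blast
qed

lemma translate_decomp:
  "Poly_Mapping.single u a * g * monomial v =
    Poly_Mapping.single (u + LM g + v) a + Poly_Mapping.single u a * tail g * monomial v"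
  by (simp add: tail_def algebra_simps mult_single)

lemma keys_translate_tail:
  assumes "monic g" "w \<in> Poly_Mapping.keys (Poly_Mapping.single u a * tail g * monomial v)"
  shows "w < u + LM g + v"
proof -
  obtain y where "y \<in> Poly_Mapping.keys (tail g)" "w = u + y + v"
    using assms(2) by (force elim!: keys_mult_word split: if_splits)
  then show ?thesis
    using keys_tail[OF assms(1)] word_add_mono by blast
qed

lemma keys_translates_less:
  assumes "f \<in> translates B {..<w}" "\<And>g. g \<in> B \<Longrightarrow> monic g"
  shows "Poly_Mapping.keys f \<subseteq> {..<w}"
  using assms(1)
proof induction
  case zero
  then show ?case by simp
next
  case (step f g u v a)
  have "Poly_Mapping.keys (Poly_Mapping.single u a * g * monomial v) \<subseteq> {..<w}"
  proof
    fix x assume x: "x \<in> Poly_Mapping.keys (Poly_Mapping.single u a * g * monomial v)"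
    from x have x': "x \<in> Poly_Mapping.keys (Poly_Mapping.single (u + LM g + v) a +
        Poly_Mapping.single u a * tail g * monomial v)"
      by (simp only: translate_decomp[symmetric])
    have "x = u + LM g + v \<or> x \<in> Poly_Mapping.keys (Poly_Mapping.single u a * tail g * monomial v)"
      using x'
        Poly_Mapping.keys_add[of "Poly_Mapping.single (u + LM g + v) a"
          "Poly_Mapping.single u a * tail g * monomial v"]
      by (auto split: if_splits)
    then show "x \<in> {..<w}"
      using keys_translate_tail[of g x u a v] assms(2) step.hyps by (auto intro: less_trans)
  qed
  then show ?case
    using step.IH Poly_Mapping.keys_add[of f] by blast
qed

text \<open>
  The hypotheses of the diamond lemma: no leading word is a factor of that of another element, and every
  composition \<open>g q - p h\<close>, formed from an overlap \<open>p s q\<close> of two leading words \<open>p s\<close> and \<open>s q\<close>, is a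
  combination of translates with leading words below that of the overlap.
\<close>

locale reduced_resolvable =
  fixes B :: "(word \<Rightarrow>\<^sub>0 'a::field) set"
  assumes monic: "g \<in> B \<Longrightarrow> monic g"
    and no_inclusion: "g \<in> B \<Longrightarrow> h \<in> B \<Longrightarrow> factor (LM g) (LM h) \<Longrightarrow> g = h"
    and overlap: "g \<in> B \<Longrightarrow> h \<in> B \<Longrightarrow> LM g = p + s \<Longrightarrow> LM h = s + q \<Longrightarrow>
      p \<noteq> 0 \<Longrightarrow> s \<noteq> 0 \<Longrightarrow> q \<noteq> 0 \<Longrightarrow>
      g * monomial q - monomial p * h \<in> translates B {..<p + s + q}"
begin

text \<open>
  Disjoint occurrences impose no condition: with \<open>LM h = h - tail h\<close> and \<open>LM g = g - tail g\<close> the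
  products \<open>g t h\<close> cancel, and what remains is below.
\<close>

lemma disjoint_occurrences:
  assumes g: "g \<in> B" and h: "h \<in> B"
  shows "g * monomial (t + LM h) - monomial (LM g + t) * h
    \<in> translates B {..<LM g + t + LM h}"
proof -
  have "g * monomial (t + LM h) - monomial (LM g + t) * h
      = tail g * monomial t * h * 1 - 1 * g * (monomial t * tail h)"
    by (simp add: tail_def algebra_simps mult_single)
  moreover have "tail g * monomial t * h * 1 \<in> translates B {..<LM g + t + LM h}"
  proof (rule translates_mult_generator[OF h])
    fix u v
    assume "u \<in> Poly_Mapping.keys (tail g * monomial t)"
      and "v \<in> Poly_Mapping.keys (1 :: word \<Rightarrow>\<^sub>0 'a)"
    then obtain u' where u': "u' \<in> Poly_Mapping.keys (tail g)" "u = u' + t" "v = 0"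
      by (force elim!: keys_mult_word split: if_splits)
    then have "u' < LM g"
      using keys_tail monic g by blast
    then show "u + LM h + v \<in> {..<LM g + t + LM h}"
      using word_add_mono[of u' "LM g" 0 "t + LM h"] u' by (simp add: add.assoc)
  qed
  moreover have "1 * g * (monomial t * tail h) \<in> translates B {..<LM g + t + LM h}"
  proof (rule translates_mult_generator[OF g])
    fix u v
    assume "u \<in> Poly_Mapping.keys (1 :: word \<Rightarrow>\<^sub>0 'a)"
      and "v \<in> Poly_Mapping.keys (monomial t * tail h)"
    then obtain v' where v': "v' \<in> Poly_Mapping.keys (tail h)" "v = t + v'" "u = 0"
      by (force elim!: keys_mult_word split: if_splits)
    then have "v' < LM h"
      using keys_tail monic h by blast
    then show "u + LM g + v \<in> {..<LM g + t + LM h}"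
      using word_add_mono[of v' "LM h" "LM g + t" 0] v' by (simp add: add.assoc)
  qed
  ultimately show ?thesis
    by (simp add: translates_diff)
qed

lemma translates_context:
  assumes "f \<in> translates B {..<w}"
  shows "monomial u * f * monomial v \<in> translates B {..<u + w + v}"
proof (rule translates_mult[OF assms])
  fix x y z
  assume "x \<in> Poly_Mapping.keys (monomial u :: word \<Rightarrow>\<^sub>0 'a)" "y \<in> {..<w}"
    "z \<in> Poly_Mapping.keys (monomial v :: word \<Rightarrow>\<^sub>0 'a)"
  then show "x + y + z \<in> {..<u + w + v}"
    using word_add_mono[of y w u v] by simp
qed

lemma occurrences_ordered:
  assumes g: "g \<in> B" and h: "h \<in> B" and eq: "LM g + v = t + LM h + v'"
  shows "g * monomial v - monomial t * h * monomial v' \<in> translates B {..<LM g + v}"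
proof -
  have equal: ?thesis if "g = h" "t = 0"
  proof -
    have "v = v'"
      using eq unfolding that by simp
    then show ?thesis
      unfolding that by (simp add: translates.zero)
  qed
  have disjoint: ?thesis if "t = LM g + r" "v = r + LM h + v'" for r
  proof -
    have "monomial 0 * (g * monomial (r + LM h) - monomial (LM g + r) * h) * monomial v'
        \<in> translates B {..<0 + (LM g + r + LM h) + v'}"
      by (rule translates_context[OF disjoint_occurrences[OF g h]])
    then show ?thesis
      by (simp add: that left_diff_distrib mult.assoc mult_single add.assoc)
  qed
  have inclusion: ?thesis if LMg: "LM g = t + LM h + x" for x
  proof (rule equal)
    show "g = h"
      using no_inclusion[OF h g] LMg by (auto simp: factor_def)
    then show "t = 0"
      using arg_cong[OF LMg, of "\<lambda>w. length (letters w)"]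
      by (intro word.expand) simp
  qed
  from eq have "LM g + v = t + (LM h + v')"
    by (simp add: add.assoc)
  then show ?thesis
  proof (cases rule: word_add_eq_addE)
    case (1 r)
    then show ?thesis
      using disjoint by (simp add: add.assoc)
  next
    case (2 s)
    from 2(2) show ?thesis
    proof (cases rule: word_add_eq_addE)
      case (1 x)
      then show ?thesis
        using inclusion 2(1) by (simp add: add.assoc)
    next
      case (2 q)
      show ?thesis
      proof (cases "t = 0 \<or> s = 0 \<or> q = 0")
        case True
        then consider "t = 0" | "s = 0" | "q = 0"
          by blast
        then show ?thesis
        proof cases
          assume t: "t = 0"
          then have "LM h = 0 + LM g + q"
            using \<open>LM g = t + s\<close> 2 by simp
          then have "g = h"
            using no_inclusion[OF g h] unfolding factor_def by blast
          then show ?thesis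
            using equal t by blast
        next
          assume "s = 0"
          then show ?thesis
            using disjoint[of 0] \<open>LM g = t + s\<close> 2 by simp
        next
          assume "q = 0"
          then show ?thesis
            using inclusion[of 0] \<open>LM g = t + s\<close> 2 by simp
        qed
      next
        case False
        then have "g * monomial q - monomial t * h \<in> translates B {..<t + s + q}"
          using overlap g h \<open>LM g = t + s\<close> 2 by blast
        then have "monomial 0 * (g * monomial q - monomial t * h) * monomial v'
            \<in> translates B {..<0 + (t + s + q) + v'}"
          by (rule translates_context)
        then show ?thesis
          using \<open>LM g = t + s\<close> 2
          by (simp add: left_diff_distrib mult.assoc mult_single add.assoc)
      qed
    qed
  qed
qed

text \<open>
  Two translates with the same leading word are interchangeable modulo smaller ones.  This is all
  that the diamond lemma needs from its hypotheses.
\<close>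

lemma same_leading_word:
  assumes g: "g \<in> B" and h: "h \<in> B"
    and eq: "u + LM g + v = u' + LM h + v'"
  shows "monomial u * g * monomial v - monomial u' * h * monomial v'
    \<in> translates B {..<u + LM g + v}"
proof -
  have ordered: "monomial u * g * monomial v - monomial u' * h * monomial v'
      \<in> translates B {..<u + LM g + v}"
    if g: "g \<in> B" and h: "h \<in> B" and eq: "u + LM g + v = u' + LM h + v'" and u': "u' = u + t"
    for g h u v u' v' t
  proof -
    have "LM g + v = t + LM h + v'"
      using eq u' by (simp add: add.assoc)
    from translates_context[OF occurrences_ordered[OF g h this], of u 0]
    show ?thesis
      by (simp add: u' right_diff_distrib mult.assoc[symmetric] mult_single add.assoc)
  qed
  from eq have "u + (LM g + v) = u' + (LM h + v')"
    by (simp add: add.assoc)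
  then show ?thesis
  proof (cases rule: word_add_eq_addE)
    case (1 t)
    then show ?thesis
      using ordered g h eq by blast
  next
    case (2 t)
    then show ?thesis
      using translates_uminus[OF ordered[OF h g eq[symmetric] 2(1)]] eq by simp
  qed
qed

text \<open>By these interchanges all translates with leading word \<open>w\<close> are collected into a single one.\<close>

lemma translates_leading_part:
  assumes "f \<in> translates B {..w}"
  shows "f \<in> translates B {..<w} \<or>
    (\<exists>g\<in>B. \<exists>u v a. w = u + LM g + v \<and>
      f - Poly_Mapping.single u a * g * monomial v \<in> translates B {..<w})"
  using assms
proof induction
  case zero
  then show ?case by (simp add: translates.zero)
next
  case (step f g u v a)
  let ?t = "\<lambda>a. Poly_Mapping.single u a * g * monomial v"
  show ?case
  proof (cases "u + LM g + v = w")
    case False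
    then have less: "u + LM g + v \<in> {..<w}"
      using step.hyps by auto
    from step.IH show ?thesis
    proof (elim disjE bexE exE conjE)
      assume "f \<in> translates B {..<w}"
      then show ?thesis
        using less step.hyps translates.step by blast
    next
      fix h u' v' b
      assume h: "h \<in> B" "w = u' + LM h + v'"
        and "f - Poly_Mapping.single u' b * h * monomial v' \<in> translates B {..<w}"
      then have "f - Poly_Mapping.single u' b * h * monomial v' + ?t a \<in> translates B {..<w}"
        using less step.hyps translates.step by blast
      then have "f + ?t a - Poly_Mapping.single u' b * h * monomial v' \<in> translates B {..<w}"
        by (simp add: algebra_simps)
      then show ?thesis
        using h by blast
    qed
  next
    case w: True
    from step.IH show ?thesis
    proof (elim disjE bexE exE conjE)
      assume "f \<in> translates B {..<w}"
      then show ?thesis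
        using w step.hyps by (intro disjI2 bexI[of _ g] exI[of _ u] exI[of _ v] exI[of _ a]) auto
    next
      fix h u' v' b
      assume h: "h \<in> B" "w = u' + LM h + v'"
        and f: "f - Poly_Mapping.single u' b * h * monomial v' \<in> translates B {..<w}"
      have "monomial u' * h * monomial v' - monomial u * g * monomial v \<in> translates B {..<w}"
        using same_leading_word[OF h(1) step.hyps(2), of u' v' u v] h(2) w by simp
      then have "Poly_Mapping.single 0 b * (monomial u' * h * monomial v' -
          monomial u * g * monomial v) * 1 \<in> translates B {..<w}"
        by (rule translates_mult) (auto split: if_splits)
      then have "Poly_Mapping.single u' b * h * monomial v' - ?t b \<in> translates B {..<w}"
        by (simp add: right_diff_distrib mult.assoc[symmetric] mult_single)
      from translates_add[OF f this]
      have "f + ?t a - ?t (a + b) \<in> translates B {..<w}"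
        by (simp add: single_add algebra_simps)
      then show ?thesis
        using w step.hyps by blast
    qed
  qed
qed

text \<open>
  By well-founded induction on a bound for the leading words in use, the bound is reached by a
  single translate.  If its coefficient is not zero its leading term cannot be cancelled, and
  otherwise the bound can be lowered.
\<close>

theorem diamond_lemma:
  assumes "f \<in> translates B UNIV" "f \<noteq> 0"
  shows "\<exists>g\<in>B. factor (LM g) (LM f)"
proof -
  have bounded: "\<exists>g\<in>B. factor (LM g) (LM f)" if "f \<in> translates B {..w}" "f \<noteq> 0" for w
    using wf_word_less that
  proof (induction w rule: wf_induct_rule)
    case (less w)
    show ?case
    proof (cases "f \<in> translates B {..<w}")
      case True
      then obtain w' where "w' < w" "f \<in> translates B {..w'}"
        using translates_bounded less.prems(2) by blast
      then show ?thesis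
        using less by blast
    next
      case False
      then obtain g u v a where g: "g \<in> B" "w = u + LM g + v"
        and r: "f - Poly_Mapping.single u a * g * monomial v \<in> translates B {..<w}"
        using translates_leading_part less.prems(1) by blast
      define r where "r = f - Poly_Mapping.single u a * g * monomial v"
      define r' where "r' = Poly_Mapping.single u a * tail g * monomial v + r"
      have "a \<noteq> 0"
        using r False by auto
      have keys: "x < w" if "x \<in> Poly_Mapping.keys r'" for x
        using that Poly_Mapping.keys_add[of "Poly_Mapping.single u a * tail g * monomial v" r]
          keys_translate_tail[OF monic[OF g(1)]] g(2) keys_translates_less[of r B w] r monic
        unfolding r'_def r_def[symmetric] by blast
      have f: "f = Poly_Mapping.single w a + r'"
        using translate_decomp[of u a g v] by (simp add: r'_def r_def g(2))
      have "LM f = w"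
      proof (rule LM_eqI)
        have "Poly_Mapping.lookup r' w = 0"
          using keys by (meson in_keys_iff less_irrefl)
        then show "Poly_Mapping.lookup f w \<noteq> 0"
          using \<open>a \<noteq> 0\<close> by (simp add: f lookup_add)
        show "x \<le> w" if "x \<in> Poly_Mapping.keys f" for x
          using that Poly_Mapping.keys_add[of "Poly_Mapping.single w a" r'] keys
          unfolding f by (fastforce split: if_splits)
      qed
      then show ?thesis
        using g unfolding factor_def by blast
    qed
  qed
  have "\<exists>w. f \<in> translates B {..w}"
    using translates_bounded assms by blast
  then show ?thesis
    using bounded assms(2) by blast
qed

end


section \<open>Alternating sums\<close>

text \<open>
  As \<open>permute_list p zs\<close> has the entry \<open>zs ! p i\<close> at position \<open>i\<close>, this cycle takes the entry at
  position \<open>b\<close> of a list of length \<open>n + 1\<close> to the end and keeps the order of the others.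
\<close>

definition move_last :: "nat \<Rightarrow> nat \<Rightarrow> nat \<Rightarrow> nat" where
  "move_last b n i = (if i < b \<or> n < i then i else if i = n then b else Suc i)"

lemma move_last_Suc:
  "b \<le> n \<Longrightarrow> move_last b (Suc n) = move_last b n \<circ> transpose n (Suc n)"
  by (auto simp: fun_eq_iff move_last_def transpose_def)

text \<open>The sign is the parity of the number of entries that the moved entry passes.\<close>

lemma move_last_permutes_sign:
  assumes "b \<le> n"
  shows "move_last b n permutes {..<Suc n} \<and> sign (move_last b n) = (- 1) ^ (n - b)"
  using assms
proof (induction n rule: dec_induct)
  case base
  have "move_last b b = id"
    by (auto simp: fun_eq_iff move_last_def)
  then show ?case
    by (simp only: permutes_id sign_id) simp
next
  case (step n)
  have t: "transpose n (Suc n) permutes {..<Suc (Suc n)}"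
    by (rule permutes_swap_id) auto
  have m: "move_last b n permutes {..<Suc (Suc n)}"
    using step.IH by (auto intro: permutes_subset)
  have "sign (move_last b (Suc n)) = sign (move_last b n) * sign (transpose n (Suc n))"
    unfolding move_last_Suc[OF step.hyps(1)]
    by (rule sign_compose) (use permutation_permutes t m in blast)+
  with step show ?case
    unfolding move_last_Suc[OF step.hyps(1)]
    by (auto simp only: permutes_compose[OF t m]) (simp add: sign_swap_id Suc_diff_le)
qed

lemmas move_last_permutes = move_last_permutes_sign[THEN conjunct1]
lemmas sign_move_last = move_last_permutes_sign[THEN conjunct2]

definition del :: "nat \<Rightarrow> 'b list \<Rightarrow> 'b list" where
  "del b zs = take b zs @ drop (Suc b) zs"

lemma length_del [simp]: "b < length zs \<Longrightarrow> length (del b zs) = length zs - 1"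
  by (simp add: del_def)

lemma permute_move_last:
  assumes "length zs = Suc n" "b \<le> n"
  shows "permute_list (move_last b n) zs = del b zs @ [zs ! b]"
  using assms
  by (auto intro!: nth_equalityI simp: permute_list_def move_last_def del_def nth_append)

lemma permute_list_append1:
  assumes "q permutes {..<length ys}"
  shows "permute_list q (ys @ [z]) = permute_list q ys @ [z]"
proof -
  have "q (length ys) = length ys" "\<And>i. i < length ys \<Longrightarrow> q i < length ys"
    using assms permutes_not_in[of q] permutes_in_image[of q "{..<length ys}"] by auto
  then show ?thesis
    by (simp add: permute_list_def nth_append)
qed

lemma sign_compose_permutes:
  fixes n :: nat
  assumes "p permutes {..<n}" "q permutes {..<n}"
  shows "sign (p \<circ> q) = sign p * sign q"
  using assms by (intro sign_compose) (auto simp: permutation_permutes intro!: exI[of _ "{..<n}"])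

text \<open>
  Every permutation of \<open>n + 1\<close> positions is uniquely of the form \<open>move_last b n \<circ> q\<close> where \<open>q\<close> fixes
  the last position.  The function \<open>h\<close> makes this usable for expansions on either side, as it may put
  the last entry in front.
\<close>

lemma signed_sum_permutations:
  fixes h :: "'b list \<Rightarrow> 'r::ring_1"
  assumes zs: "length zs = Suc n"
  shows "(\<Sum>p | p permutes {..<Suc n}. of_int (sign p) * h (permute_list p zs)) =
    (\<Sum>b\<le>n. (- 1) ^ (n - b) *
      (\<Sum>q | q permutes {..<n}. of_int (sign q) * h (permute_list q (del b zs) @ [zs ! b])))"
proof -
  define f :: "(nat \<Rightarrow> nat) \<Rightarrow> 'r" where "f p = of_int (sign p) * h (permute_list p zs)" for p
  have "(\<Sum>p | p permutes {..<Suc n}. f p) =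
      (\<Sum>b\<le>n. \<Sum>q | q permutes {..<n}. f (transpose n b \<circ> q))"
    using sum_over_permutations_insert[of "{..<n}" n f]
    by (simp add: lessThan_Suc[symmetric] lessThan_Suc_atMost)
  also have "\<dots> = (\<Sum>b\<le>n. \<Sum>q | q permutes {..<n}. f (move_last b n \<circ> q))"
  proof (rule sum.cong[OF refl])
    fix b assume "b \<in> {..n}"
    then have b: "b \<le> n" by simp
    have m: "move_last b n permutes {..<Suc n}"
      by (rule move_last_permutes[OF b])
    \<comment> \<open>\<open>sum_over_permutations_insert\<close> splits off transpositions; \<open>r\<close> turns them into the order-preserving cycles.\<close>
    define r where "r = inv_into UNIV (move_last b n) \<circ> transpose n b"
    have "r permutes {..<Suc n}"
      unfolding r_def using b m
      by (intro permutes_compose[OF permutes_swap_id permutes_inv]) auto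
    moreover have "r n = n"
      using permutes_inverses(2)[OF m, of n] b by (simp add: r_def move_last_def)
    ultimately have "r permutes {..<n}"
      by (rule_tac permutes_superset[of r "{..<Suc n}"]) auto
    then have r: "(\<Sum>q | q permutes {..<n}. f (move_last b n \<circ> q)) =
        (\<Sum>q | q permutes {..<n}. f (move_last b n \<circ> (r \<circ> q)))"
      by (rule setum_permutations_compose_left)
    have cancel: "move_last b n \<circ> (r \<circ> q) = transpose n b \<circ> q" for q
      using permutes_inverses(1)[OF m] by (simp add: r_def fun_eq_iff)
    show "(\<Sum>q | q permutes {..<n}. f (transpose n b \<circ> q)) =
        (\<Sum>q | q permutes {..<n}. f (move_last b n \<circ> q))"
      unfolding r cancel ..
  qed
  also have "\<dots> = (\<Sum>b\<le>n. \<Sum>q | q permutes {..<n}. (- 1) ^ (n - b) *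
      (of_int (sign q) * h (permute_list q (del b zs) @ [zs ! b])))"
  proof (intro sum.cong refl)
    fix b q assume "b \<in> {..n}" and "q \<in> {q. q permutes {..<n}}"
    then have b: "b \<le> n" and q: "q permutes {..<n}" by auto
    have q': "q permutes {..<Suc n}"
      using q by (rule permutes_subset) auto
    have "permute_list (move_last b n \<circ> q) zs = permute_list q (del b zs) @ [zs ! b]"
      using permute_list_compose[of q zs "move_last b n"] q q' zs b
      by (simp add: permute_move_last permute_list_append1)
    moreover have "sign (move_last b n \<circ> q) = (- 1) ^ (n - b) * sign q"
      by (simp add: sign_compose_permutes[OF move_last_permutes[OF b] q'] sign_move_last[OF b])
    ultimately show "f (move_last b n \<circ> q) = (- 1) ^ (n - b) *
        (of_int (sign q) * h (permute_list q (del b zs) @ [zs ! b]))"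
      by (simp add: f_def mult.assoc)
  qed
  finally show ?thesis
    by (simp add: f_def sum_distrib_left)
qed

lemma alt_expand_right:
  fixes zs :: "'r::ring_1 list"
  assumes "length zs = Suc n"
  shows "alt zs = (\<Sum>b\<le>n. (- 1) ^ (n - b) * (alt (del b zs) * zs ! b))"
  using signed_sum_permutations[OF assms, of prod_list] assms
  by (simp add: alt_def sum_distrib_right mult.assoc)

text \<open>
  Moving the first factor of each product to the end is a permutation of the positions of sign
  \<open>(- 1) ^ n\<close>.  Thus, up to this sign, the alternating sum may be formed with the last entry of each
  arrangement as the first factor, and splitting off the last entry gives the expansion on the left.
\<close>

lemma alt_expand_left:
  fixes zs :: "'r::ring_1 list"
  assumes "length zs = Suc n"
  shows "alt zs = (\<Sum>b\<le>n. (- 1) ^ b * (zs ! b * alt (del b zs)))"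
proof -
  define h :: "'r list \<Rightarrow> 'r" where "h xs = prod_list (last xs # butlast xs)" for xs
  let ?m = "move_last 0 n"
  have m: "?m permutes {..<Suc n}" and sign_m: "sign ?m = (- 1) ^ n"
    using move_last_permutes[of 0 n] sign_move_last[of 0 n] by auto
  have rotate: "h (permute_list (p \<circ> ?m) zs) = prod_list (permute_list p zs)" for p
  proof -
    obtain x xs where p: "permute_list p zs = x # xs"
      using assms by (metis length_Suc_conv length_permute_list)
    have "permute_list (p \<circ> ?m) zs = permute_list ?m (permute_list p zs)"
      using m assms permute_list_compose[of ?m zs p] by simp
    also have "\<dots> = xs @ [x]"
      using permute_move_last[of "x # xs" n 0] assms length_permute_list[of p zs]
      unfolding p by (simp add: del_def)
    finally show ?thesis
      by (simp add: h_def p)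
  qed
  have "(\<Sum>p | p permutes {..<Suc n}. of_int (sign p) * h (permute_list p zs)) =
      (\<Sum>p | p permutes {..<Suc n}. of_int (sign (p \<circ> ?m)) * h (permute_list (p \<circ> ?m) zs))"
    by (rule sum_permutations_compose_right[OF m])
  also have "\<dots> = (- 1) ^ n * alt zs"
    unfolding alt_def sum_distrib_left assms
    using m sign_m by (intro sum.cong) (auto simp: sign_compose_permutes rotate mult.assoc[symmetric] mult.commute[of "sign _"])
  finally have alt: "alt zs = (- 1) ^ n *
      (\<Sum>p | p permutes {..<Suc n}. of_int (sign p) * h (permute_list p zs))"
    by (cases "even n") simp_all
  have commute: "of_int k * (z * y) = z * (of_int k * y)" for k and y z :: 'r
    by (metis mult.assoc mult_of_int_commute)
  have "(- 1) ^ n * (\<Sum>p | p permutes {..<Suc n}. of_int (sign p) * h (permute_list p zs)) =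
      (\<Sum>b\<le>n. (- 1) ^ n * ((- 1) ^ (n - b) * (zs ! b * alt (del b zs))))"
    unfolding signed_sum_permutations[OF assms] sum_distrib_left
    using assms
    by (intro sum.cong)
      (auto simp: alt_def sum_distrib_left h_def commute)
  also have "\<dots> = (\<Sum>b\<le>n. (- 1) ^ b * (zs ! b * alt (del b zs)))"
  proof (intro sum.cong refl)
    fix b assume "b \<in> {..n}"
    then have "(- 1) ^ n * (- 1) ^ (n - b) = ((- 1) ^ b :: 'r)"
      by (simp add: minus_one_power_iff)
    then show "(- 1) ^ n * ((- 1) ^ (n - b) * (zs ! b * alt (del b zs))) =
        (- 1) ^ b * (zs ! b * alt (del b zs))"
      by (simp add: mult.assoc[symmetric])
  qed
  finally show ?thesis
    unfolding alt .
qed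

definition reversal :: "nat \<Rightarrow> nat \<Rightarrow> nat" where
  "reversal n i = (if i < n then n - 1 - i else i)"

text \<open>
  A list is reversed by moving its first entry to the end and then reversing the entries in front of
  it.  This recursion yields the sign \<open>(- 1) ^ (n div 2)\<close> of the reversal.
\<close>

lemma reversal_Suc: "reversal (Suc n) = move_last 0 n \<circ> reversal n"
  by (auto simp: fun_eq_iff reversal_def move_last_def)

lemma reversal_permutes_sign:
  "reversal n permutes {..<n} \<and> sign (reversal n) = (- 1) ^ (n div 2)"
proof (induction n)
  case 0
  have "reversal 0 = id"
    by (auto simp: fun_eq_iff reversal_def)
  then show ?case
    by (simp only: permutes_id sign_id) simp
next
  case (Suc n)
  have r: "reversal n permutes {..<Suc n}"
    using Suc by (auto intro: permutes_subset)
  have "even n \<Longrightarrow> Suc n div 2 = n div 2" "odd n \<Longrightarrow> Suc n div 2 = Suc (n div 2)"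
    by presburger+
  then have "sign (move_last 0 n \<circ> reversal n) = (- 1) ^ (Suc n div 2)"
    using Suc sign_compose_permutes[OF move_last_permutes[of 0 n] r] sign_move_last[of 0 n]
    by (cases "even n") auto
  then show ?case
    unfolding reversal_Suc using permutes_compose[OF r move_last_permutes[of 0 n]] by blast
qed

lemma permute_reversal: "permute_list (reversal (length xs)) xs = rev xs"
  by (auto intro!: nth_equalityI simp: permute_list_def reversal_def rev_nth)


section \<open>The leading words of the relations\<close>

lemma prod_list_var: "prod_list (map var xs) = monomial (Word xs)"
proof (induction xs)
  case Nil
  then show ?case by (simp add: zero_word_def[symmetric])
next
  case (Cons x xs)
  then show ?case by (simp add: var_def mult_single plus_word_def)
qed

lemma alt_var:
  "alt (map var xs) = (\<Sum>p | p permutes {..<length xs}.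
    Poly_Mapping.single (Word (permute_list p xs)) (of_int (sign p)))"
proof -
  have "of_int (sign p) * monomial w = Poly_Mapping.single w (of_int (sign p))" for p w
    by (simp add: mult_single flip: single_of_int)
  then show ?thesis
    unfolding alt_def length_map
    by (intro sum.cong refl) (simp add: permute_list_map prod_list_var)
qed

lemma permute_list_inj:
  assumes "distinct xs" "p permutes {..<length xs}" "q permutes {..<length xs}"
    and eq: "permute_list p xs = permute_list q xs"
  shows "p = q"
proof
  fix i
  show "p i = q i"
  proof (cases "i < length xs")
    case True
    then have "xs ! p i = xs ! q i"
      using assms by (metis permute_list_nth)
    then show ?thesis
      using True assms permutes_in_image[of _ "{..<length xs}"] by (simp add: nth_eq_iff_index_eq)
  next
    case False
    then show ?thesis
      using assms by (simp add: permutes_not_in)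
  qed
qed

lemma decreasing_word_greatest:
  assumes "sorted_wrt (\<ge>) ys" "mset xs = mset ys"
  shows "Word xs \<le> Word ys"
  using assms
proof (induction ys arbitrary: xs)
  case Nil
  then show ?case by simp
next
  case (Cons y ys)
  then obtain x xs' where xs: "xs = x # xs'"
    by (metis list.exhaust mset_zero_iff_right list.distinct(1))
  have len: "length xs' = length ys"
    using Cons.prems(2) xs by (metis length_Cons nat.inject size_mset)
  have "x \<in> set (y # ys)"
    using Cons.prems(2) xs by (metis list.set_intros(1) mset_eq_setD)
  then have "x < y \<or> x = y"
    using Cons.prems(1) by (auto simp: le_less)
  then show ?case
  proof
    assume "x < y"
    then show ?thesis
      by (simp add: less_eq_word_def less_word_def xs Cons_lenlex_iff len)
  next
    assume "x = y"
    then have "Word xs' \<le> Word ys"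
      using Cons xs by simp
    then show ?thesis
      using \<open>x = y\<close> by (auto simp: less_eq_word_def less_word_def xs Cons_lenlex_iff)
  qed
qed

lemma keys_alt_var:
  fixes w :: word
  assumes "w \<in> Poly_Mapping.keys (alt (map var xs) :: word \<Rightarrow>\<^sub>0 'a::field)"
  shows "mset (letters w) = mset xs"
proof -
  obtain p where "p permutes {..<length xs}"
    "w \<in> Poly_Mapping.keys (Poly_Mapping.single (Word (permute_list p xs)) (of_int (sign p) :: 'a))"
    using assms keys_sum[of "\<lambda>p. Poly_Mapping.single (Word (permute_list p xs)) (of_int (sign p) :: 'a)"]
    unfolding alt_var by blast
  then show ?thesis
    by (simp split: if_splits)
qed

lemma lookup_alt_var_rev:
  assumes "distinct xs"
  shows "Poly_Mapping.lookup (alt (map var xs) :: word \<Rightarrow>\<^sub>0 'a::field) (Word (rev xs))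
    = (- 1) ^ (length xs div 2)"
proof -
  let ?P = "{p. p permutes {..<length xs}}" and ?r = "reversal (length xs)"
  have r: "?r permutes {..<length xs}" "sign ?r = (- 1) ^ (length xs div 2)"
    using reversal_permutes_sign by auto
  have "Word (permute_list p xs) = Word (rev xs) \<longleftrightarrow> p = ?r" if "p \<in> ?P" for p
    using permute_list_inj[OF assms, of p ?r] that r by (auto simp: permute_reversal)
  then have "Poly_Mapping.lookup (alt (map var xs) :: word \<Rightarrow>\<^sub>0 'a) (Word (rev xs))
      = (\<Sum>p\<in>?P. if p = ?r then of_int (sign p) else 0)"
    unfolding alt_var lookup_sum lookup_single when_def by (intro sum.cong) auto
  also have "\<dots> = (- 1) ^ (length xs div 2)"
    using r by (simp add: sum.delta finite_permutations)
  finally show ?thesis .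
qed

definition without :: "nat \<Rightarrow> nat \<Rightarrow> nat list" where
  "without n i = filter (\<lambda>j. j \<noteq> i) [1..<n + 2]"

lemma omit_eq: "omit n i z = map z (without n i)"
  by (simp add: omit_def without_def)

lemma set_without [simp]: "set (without n i) = {1..n + 1} - {i}"
  by (auto simp: without_def)

lemma distinct_without [simp]: "distinct (without n i)"
  by (simp add: without_def)

lemma length_without: "i \<in> {1..n + 1} \<Longrightarrow> length (without n i) = n"
  using distinct_card[OF distinct_without[of n i]] by simp

lemma decreasing_rev_without: "sorted_wrt (>) (rev (without n i))"
  unfolding sorted_wrt_rev without_def by (intro sorted_wrt_filter) (simp del: upt_Suc)

lemma decreasing_rev_without_le: "sorted_wrt (\<ge>) (rev (without n i))"
  using decreasing_rev_without by (rule sorted_wrt_mono_rel[rotated]) simp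

lemma keys_G:
  assumes "w \<in> Poly_Mapping.keys (G n i :: word \<Rightarrow>\<^sub>0 'a::field)"
  shows "mset (letters w) = mset (without n i) \<or> w = Word [i]"
proof -
  have sign: "Poly_Mapping.keys ((- 1) ^ k * f) = Poly_Mapping.keys f" for k and f :: "word \<Rightarrow>\<^sub>0 'a"
    by (cases "even k") simp_all
  have "w \<in> Poly_Mapping.keys (alt (omit n i var) :: word \<Rightarrow>\<^sub>0 'a) \<or>
      w \<in> Poly_Mapping.keys ((- 1) ^ (n + i + 1) * var i :: word \<Rightarrow>\<^sub>0 'a)"
    using assms keys_diff[of "alt (omit n i var)" "(- 1) ^ (n + i + 1) * var i :: word \<Rightarrow>\<^sub>0 'a"]
    unfolding G_def sign by blast
  then show ?thesis
    using keys_alt_var[of w "without n i"] unfolding sign omit_eq by (auto simp: var_def)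
qed

text \<open>
  The decreasing word arises in the alternating sum from the reversal alone, whose sign is the factor
  \<open>(- 1) ^ (n div 2)\<close> in the definition of \<open>G\<close>; the two signs cancel.
\<close>

lemma lookup_G:
  assumes "n \<ge> 2" "i \<in> {1..n + 1}"
  shows "Poly_Mapping.lookup (G n i :: word \<Rightarrow>\<^sub>0 'a::field) (Word (rev (without n i))) = 1"
proof -
  have sign: "Poly_Mapping.lookup ((- 1) ^ k * f) w = (- 1) ^ k * Poly_Mapping.lookup f w"
    for k w and f :: "word \<Rightarrow>\<^sub>0 'a"
    by (cases "even k") simp_all
  have "[i] \<noteq> rev (without n i)"
    using assms length_without[OF assms(2)] by (metis One_nat_def length_Cons length_rev list.size(3)
        not_less_eq_eq numeral_2_eq_2 order_refl)
  then show ?thesis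
    using assms
    by (simp add: G_def sign lookup_minus lookup_add omit_eq lookup_alt_var_rev length_without var_def
        lookup_single power_mult_distrib[symmetric])
qed

text \<open>
  All words of the alternating sum rearrange the same distinct letters, the decreasing one is the
  largest of them, and the additional word \<open>x\<^sub>i\<close> is shorter because \<open>n \<ge> 2\<close>.
\<close>

lemma LM_G:
  assumes "n \<ge> 2" "i \<in> {1..n + 1}"
  shows "LM (G n i :: word \<Rightarrow>\<^sub>0 'a::field) = Word (rev (without n i))"
proof (rule LM_eqI)
  show "Poly_Mapping.lookup (G n i :: word \<Rightarrow>\<^sub>0 'a) (Word (rev (without n i))) \<noteq> 0"
    using lookup_G[OF assms, where 'a = 'a] by simp
  fix w assume "w \<in> Poly_Mapping.keys (G n i :: word \<Rightarrow>\<^sub>0 'a)"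
  then consider "mset (letters w) = mset (without n i)" | "w = Word [i]"
    using keys_G by blast
  then show "w \<le> Word (rev (without n i))"
  proof cases
    case 1
    then show ?thesis
      using decreasing_word_greatest[OF decreasing_rev_without_le, of "letters w" n i] by simp
  next
    case 2
    then show ?thesis
      using assms by (simp add: less_eq_word_def less_word_def lenlex_conv length_without)
  qed
qed

lemma monic_G:
  "n \<ge> 2 \<Longrightarrow> i \<in> {1..n + 1} \<Longrightarrow> monic (G n i :: word \<Rightarrow>\<^sub>0 'a::field)"
  by (simp add: monic_def LM_G lookup_G)


section \<open>A syzygy from the two expansions\<close>

lemma del_var: "b \<le> n \<Longrightarrow> del b (map z [1..<n + 2]) = omit n (Suc b) z"
proof -
  assume b: "b \<le> n"
  have "[1..<n + 2] = [1..<Suc b] @ [Suc b..<n + 2]"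
    using b upt_add_eq_append[of 1 "Suc b" "n + 1 - b"] by simp
  also have "[Suc b..<n + 2] = Suc b # [Suc (Suc b)..<n + 2]"
    using b by (simp add: upt_conv_Cons)
  finally have split: "[1..<n + 2] = [1..<Suc b] @ Suc b # [Suc (Suc b)..<n + 2]" .
  have "without n (Suc b) = [1..<Suc b] @ [Suc (Suc b)..<n + 2]"
    unfolding without_def split by (simp add: filter_id_conv del: upt_Suc)
  then show ?thesis
    unfolding del_def omit_eq split by (simp del: upt_Suc)
qed

text \<open>
  The difference of the expansions of \<open>alt(x\<^sub>1, \<dots>, x\<^sub>n\<^sub>+\<^sub>1)\<close> on the left and on the right, in which
  each \<open>alt\<close> with one letter omitted is replaced by \<open>\<plusminus> G\<^sub>i\<close> plus the bracket value \<open>\<plusminus> x\<^sub>i\<close>.  The squares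
  come from the bracket values: their signs are \<open>(- 1) ^ n\<close> on the left and \<open>1\<close> on the right for every
  \<open>i\<close>, which is the effect of the signs in the multiplication table.
\<close>

lemma relation_between_relations:
  fixes n :: nat
  defines "x \<equiv> \<lambda>b. (var (Suc b) :: word \<Rightarrow>\<^sub>0 'a::field)"
    and "g \<equiv> \<lambda>b. (G n (Suc b) :: word \<Rightarrow>\<^sub>0 'a)"
  shows "(\<Sum>b\<le>n. (- 1) ^ b * (x b * g b)) - (- 1) ^ n * (\<Sum>b\<le>n. (- 1) ^ b * (g b * x b))
    = (- 1) ^ (n div 2) * ((1 - (- 1) ^ n) * (\<Sum>b\<le>n. x b * x b))"
proof -
  define s :: "word \<Rightarrow>\<^sub>0 'a" where "s = (- 1) ^ (n div 2)"
  have s: "s = 1 \<or> s = - 1"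
    by (cases "even (n div 2)") (simp_all add: s_def)
  define A where "A b = (alt (omit n (Suc b) var) :: word \<Rightarrow>\<^sub>0 'a)" for b
  have A: "A b = s * g b + (- 1) ^ (n + b) * x b" for b
    using s by (auto simp: g_def G_def s_def[symmetric] A_def x_def)
  let ?v = "map var [1..<n + 2] :: (word \<Rightarrow>\<^sub>0 'a) list"
  have len: "length ?v = Suc n"
    by simp
  have nth: "?v ! b = x b" "del b ?v = omit n (Suc b) var" if "b \<le> n" for b
    using that del_var[OF that, of var] by (auto simp: x_def simp del: upt_Suc)
  have "(\<Sum>b\<le>n. (- 1) ^ b * (x b * A b)) = alt ?v"
    unfolding alt_expand_left[OF len] A_def using nth by (intro sum.cong) auto
  also have "alt ?v = (\<Sum>b\<le>n. (- 1) ^ (n - b) * (A b * x b))"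
    unfolding alt_expand_right[OF len] A_def using nth by (intro sum.cong) auto
  also have "(\<Sum>b\<le>n. (- 1) ^ b * (x b * A b)) =
      (\<Sum>b\<le>n. s * ((- 1) ^ b * (x b * g b)) + (- 1) ^ n * (x b * x b))"
    unfolding A using s
    by (intro sum.cong refl) (auto simp: minus_one_power_iff algebra_simps)
  also have "(\<Sum>b\<le>n. (- 1) ^ (n - b) * (A b * x b)) =
      (\<Sum>b\<le>n. s * ((- 1) ^ n * ((- 1) ^ b * (g b * x b))) + x b * x b)"
    unfolding A using s
    by (intro sum.cong refl) (auto simp: minus_one_power_iff algebra_simps)
  finally have eq: "s * (\<Sum>b\<le>n. (- 1) ^ b * (x b * g b)) + (- 1) ^ n * (\<Sum>b\<le>n. x b * x b)
      = s * ((- 1) ^ n * (\<Sum>b\<le>n. (- 1) ^ b * (g b * x b))) + (\<Sum>b\<le>n. x b * x b)"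
    by (simp add: sum.distrib sum_distrib_left)
  have ss: "s * (s * f) = f" for f
    using s by auto
  have "s * ((\<Sum>b\<le>n. (- 1) ^ b * (x b * g b)) - (- 1) ^ n * (\<Sum>b\<le>n. (- 1) ^ b * (g b * x b)))
      = (1 - (- 1) ^ n) * (\<Sum>b\<le>n. x b * x b)"
    using eq by (simp add: algebra_simps)
  from arg_cong[OF this, of "\<lambda>f. s * f"] show ?thesis
    unfolding ss unfolding s_def .
qed


section \<open>Even arity\<close>

text \<open>
  In \<open>p s\<close> the letters of \<open>s\<close> are below some letter and in \<open>s q\<close> they are above some letter.  So the
  largest letter \<open>x\<^sub>n\<^sub>+\<^sub>1\<close> is missing in \<open>s q\<close> and the smallest letter \<open>x\<^sub>1\<close> in \<open>p s\<close>; since only one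
  letter is missing in each, this determines both words.
\<close>

lemma unique_overlap:
  assumes i: "i \<in> {1..n + 1}" and j: "j \<in> {1..n + 1}"
    and ps: "rev (without n i) = p @ s" and sq: "rev (without n j) = s @ q"
    and ne: "p \<noteq> []" "s \<noteq> []" "q \<noteq> []"
  shows "i = 1 \<and> j = n + 1 \<and> p = [n + 1] \<and> q = [1]"
proof -
  have p_s: "x > y" if "x \<in> set p" "y \<in> set s" for x y
    using decreasing_rev_without[of n i] that by (auto simp: ps sorted_wrt_append)
  have s_q: "x > y" if "x \<in> set s" "y \<in> set q" for x y
    using decreasing_rev_without[of n j] that by (auto simp: sq sorted_wrt_append)
  have sets: "set p \<union> set s = {1..n + 1} - {i}" "set s \<union> set q = {1..n + 1} - {j}"
    using arg_cong[OF ps, of set] arg_cong[OF sq, of set] by auto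
  have dist: "distinct p" "distinct q"
    using distinct_without[of n i] distinct_without[of n j] ps sq
    by (metis distinct_append distinct_rev)+
  obtain x y z where xyz: "x \<in> set p" "y \<in> set s" "z \<in> set q"
    using ne by (meson last_in_set)
  have "x \<in> {1..n + 1}" "z \<in> {1..n + 1}"
    using xyz sets by blast+
  then have bounds: "x \<le> n + 1" "1 \<le> z"
    by auto
  have "n + 1 \<notin> set s \<union> set q"
    using p_s s_q xyz bounds by (metis Un_iff leD less_trans)
  then have j: "j = n + 1"
    using sets(2) by simp
  have "1 \<notin> set p \<union> set s"
    using p_s s_q xyz bounds by (metis Un_iff leD less_trans)
  then have i: "i = 1"
    using sets(1) by simp
  have "set p \<subseteq> {n + 1}"
  proof
    fix k assume k: "k \<in> set p"
    then have "k \<notin> set s \<union> set q"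
      using p_s s_q xyz by (metis Un_iff less_asym less_irrefl)
    then show "k \<in> {n + 1}"
      using k sets(1) sets(2)[unfolded j] by (metis Diff_iff UnI1 insertI1 singletonI)
  qed
  moreover have "set q \<subseteq> {1}"
  proof
    fix k assume k: "k \<in> set q"
    then have "k \<notin> set p \<union> set s"
      using p_s s_q xyz by (metis Un_iff less_asym less_irrefl)
    then show "k \<in> {1}"
      using k sets(2) sets(1)[unfolded i] by (metis Diff_iff UnI2 insertI1 singletonI)
  qed
  moreover have singleton: "xs = [a]" if "distinct xs" "xs \<noteq> []" "set xs \<subseteq> {a}" for xs and a :: nat
    using that by (cases xs; cases "tl xs") auto
  ultimately show ?thesis
    using i j dist ne by blast
qed

lemma word_less_top:
  assumes "mset (letters w) = mset [1..<n + 2]" "letters w \<noteq> rev [1..<n + 2]"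
  shows "w < Word (rev [1..<n + 2])"
proof -
  have "sorted_wrt (>) (rev [1..<n + 2])"
    unfolding sorted_wrt_rev by (simp del: upt_Suc)
  then have "sorted_wrt (\<ge>) (rev [1..<n + 2])"
    by (rule sorted_wrt_mono_rel[rotated]) simp
  then have "w \<le> Word (rev [1..<n + 2])"
    using decreasing_word_greatest[of "rev [1..<n + 2]" "letters w"] assms(1) by simp
  moreover have "w \<noteq> Word (rev [1..<n + 2])"
    using assms(2) by auto
  ultimately show ?thesis
    by simp
qed

lemma mset_without: "i \<in> {1..n + 1} \<Longrightarrow> mset (i # without n i) = mset [1..<n + 2]"
  by (intro set_eq_iff_mset_eq_distinct[THEN iffD1]) (auto simp del: upt_Suc)

text \<open>
  Two terms of the syzygy, those with \<open>x\<^sub>n\<^sub>+\<^sub>1\<close> on the left and with \<open>x\<^sub>1\<close> on the right, have the leading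
  word \<open>x\<^sub>n\<^sub>+\<^sub>1 \<dots> x\<^sub>1\<close>, and they make up the composition.  Every other term has as its leading word a
  different rearrangement of the same letters, hence a smaller one.
\<close>

lemma resolve_overlap:
  fixes n :: nat
  defines "B \<equiv> G n ` {1..n + 1} :: (word \<Rightarrow>\<^sub>0 'a::field) set"
  assumes n: "n \<ge> 2" "even n"
  shows "G n 1 * var 1 - var (n + 1) * G n (n + 1) \<in> translates B {..<Word (rev [1..<n + 2])}"
proof -
  let ?T = "translates B {..<Word (rev [1..<n + 2])}"
  let ?l = "\<lambda>b. (- 1) ^ b * (var (Suc b) * G n (Suc b)) :: word \<Rightarrow>\<^sub>0 'a"
  let ?r = "\<lambda>b. (- 1) ^ b * (G n (Suc b) * var (Suc b)) :: word \<Rightarrow>\<^sub>0 'a"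
  have "(\<Sum>b\<le>n. ?l b) = (\<Sum>b\<le>n. ?r b)"
    using relation_between_relations[of n, where 'a = 'a] n by simp
  moreover have "(\<Sum>b\<le>n. ?l b) = (\<Sum>b<n. ?l b) + ?l n"
    by (simp add: lessThan_Suc_atMost[symmetric])
  moreover have "(\<Sum>b\<le>n. ?r b) = ?r 0 + (\<Sum>b\<in>{1..n}. ?r b)"
    by (simp add: atMost_atLeast0 sum.atLeast_Suc_atMost)
  ultimately have eq: "G n 1 * var 1 - var (n + 1) * G n (n + 1) = (\<Sum>b<n. ?l b) - (\<Sum>b\<in>{1..n}. ?r b)"
    using n by (simp add: algebra_simps)
  have left: "?l b \<in> ?T" if b: "b < n" for b
  proof -
    have i: "Suc b \<in> {1..n + 1}"
      using b by auto
    have "rev [1..<n + 2] = (n + 1) # rev [1..<n + 1]"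
      by simp
    then have "Suc b # rev (without n (Suc b)) \<noteq> rev [1..<n + 2]"
      using b by (simp del: upt_Suc)
    then have less: "Word [Suc b] + Word (rev (without n (Suc b))) < Word (rev [1..<n + 2])"
      using mset_without[OF i] by (intro word_less_top) (simp_all del: upt_Suc)
    have "var (Suc b) * G n (Suc b) * 1 \<in> ?T"
      by (rule translates_mult_generator)
        (use i less n in \<open>auto simp: B_def LM_G var_def split: if_splits\<close>)
    then show ?thesis
      using translates_sign by (simp only: mult_1_right)
  qed
  have right: "?r b \<in> ?T" if b: "b \<in> {1..n}" for b
  proof -
    have i: "Suc b \<in> {1..n + 1}"
      using b by auto
    have "rev [1..<n + 2] = rev [Suc 1..<n + 2] @ [1]"
      by (simp add: upt_conv_Cons del: upt_Suc)
    then have "rev (without n (Suc b)) @ [Suc b] \<noteq> rev [1..<n + 2]"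
      using b by simp
    then have less: "Word (rev (without n (Suc b))) + Word [Suc b] < Word (rev [1..<n + 2])"
      using mset_without[OF i] by (intro word_less_top) (simp_all del: upt_Suc)
    have "1 * G n (Suc b) * var (Suc b) \<in> ?T"
      by (rule translates_mult_generator)
        (use i less n in \<open>auto simp: B_def LM_G var_def split: if_splits\<close>)
    then show ?thesis
      using translates_sign by (simp only: mult_1_left)
  qed
  show ?thesis
    unfolding eq by (intro translates_diff translates_sum) (use left right in auto)
qed

lemma reduced_resolvable_G:
  assumes n: "n \<ge> 2" "even n"
  shows "reduced_resolvable (G n ` {1..n + 1} :: (word \<Rightarrow>\<^sub>0 'a::field) set)"
proof
  show "monic g" if "g \<in> G n ` {1..n + 1}" for g :: "word \<Rightarrow>\<^sub>0 'a"
    using that monic_G[OF n(1)] by blast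
next
  fix g h :: "word \<Rightarrow>\<^sub>0 'a"
  assume "g \<in> G n ` {1..n + 1}" "h \<in> G n ` {1..n + 1}" and factor: "factor (LM g) (LM h)"
  then obtain i j where i: "i \<in> {1..n + 1}" "g = G n i" and j: "j \<in> {1..n + 1}" "h = G n j"
    by blast
  obtain u v where "Word (rev (without n j)) = u + Word (rev (without n i)) + v"
    using factor i j n unfolding factor_def by (auto simp: LM_G)
  from arg_cong[OF this, of letters]
  have eq: "rev (without n j) = letters u @ rev (without n i) @ letters v"
    by simp
  from arg_cong[OF this, of length] have "letters u = []" "letters v = []"
    using i j by (simp_all add: length_without)
  then have "set (without n j) = set (without n i)"
    using eq by simp
  then have "{1..n + 1} - {j} = {1..n + 1} - {i}"
    by (simp only: set_without)
  then have "i = j"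
    using i(1) j(1) by blast
  then show "g = h"
    using i j by simp
next
  fix g h :: "word \<Rightarrow>\<^sub>0 'a" and p s q
  assume "g \<in> G n ` {1..n + 1}" "h \<in> G n ` {1..n + 1}"
    and ps: "LM g = p + s" and sq: "LM h = s + q" and ne: "p \<noteq> 0" "s \<noteq> 0" "q \<noteq> 0"
  then obtain i j where i: "i \<in> {1..n + 1}" "g = G n i" and j: "j \<in> {1..n + 1}" "h = G n j"
    by blast
  have "rev (without n i) = letters p @ letters s" "rev (without n j) = letters s @ letters q"
    using arg_cong[OF ps, of letters] arg_cong[OF sq, of letters]
    by (simp_all add: i(2) j(2) LM_G[OF n(1) i(1)] LM_G[OF n(1) j(1)])
  moreover have "letters p \<noteq> []" "letters s \<noteq> []" "letters q \<noteq> []"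
    using ne by (metis letters_zero word.expand)+
  ultimately have *: "i = 1 \<and> j = n + 1 \<and> letters p = [n + 1] \<and> letters q = [1]"
    using unique_overlap i(1) j(1) by blast
  then have p: "p = Word [n + 1]" and q: "q = Word [1]"
    by (simp_all add: word.expand)
  have "without n 1 = [Suc 1..<n + 2]"
    unfolding without_def by (simp add: upt_conv_Cons filter_id_conv del: upt_Suc)
  then have "p + s + q = Word (rev [1..<n + 2])"
    using ps i * q n by (simp add: LM_G plus_word_def upt_conv_Cons del: upt_Suc)
  then show "g * monomial q - monomial p * h \<in> translates (G n ` {1..n + 1}) {..<p + s + q}"
    using resolve_overlap[OF n, where 'a = 'a] i j * by (simp add: p q var_def)
qed


section \<open>The generated ideal\<close>

lemma G_in_free_algebra:
  assumes "i \<in> {1..n + 1}"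
  shows "G n i \<in> carrier (free_algebra n :: (word \<Rightarrow>\<^sub>0 'a::field) ring)"
proof -
  have "set (letters w) \<subseteq> {1..n + 1}" if "w \<in> Poly_Mapping.keys (G n i :: word \<Rightarrow>\<^sub>0 'a)" for w
    using keys_G[OF that] assms mset_eq_setD[of "letters w" "without n i"] by auto
  then show ?thesis
    by (simp add: free_algebra_def)
qed

lemma free_algebra_simps [simp]:
  "f \<otimes>\<^bsub>free_algebra n\<^esub> h = f * h" "f \<oplus>\<^bsub>free_algebra n\<^esub> h = f + h"
  "\<zero>\<^bsub>free_algebra n\<^esub> = 0" "\<one>\<^bsub>free_algebra n\<^esub> = 1"
  by (simp_all add: free_algebra_def)

lemma a_inv_free_algebra:
  assumes "f \<in> carrier (free_algebra n)"
  shows "- f \<in> carrier (free_algebra n)" "\<ominus>\<^bsub>free_algebra n\<^esub> f = - f"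
proof -
  interpret ring "free_algebra n" by (rule ring_free_algebra)
  show minus: "- f \<in> carrier (free_algebra n)"
    using assms by (simp add: free_algebra_def)
  show "\<ominus>\<^bsub>free_algebra n\<^esub> f = - f"
    by (rule minus_equality) (use assms minus in simp_all)
qed

text \<open>
  The words \<open>u\<close>, \<open>v\<close> in the translates \<open>u g v\<close> may contain letters outside \<open>x\<^sub>1, \<dots>, x\<^sub>n\<^sub>+\<^sub>1\<close>.  The span of all
  translates still meets \<open>free_algebra n\<close> in an ideal that contains \<open>B\<close>, which gives the inclusion.
\<close>

lemma genideal_translates:
  assumes B: "B \<subseteq> carrier (free_algebra n)"
  shows "genideal (free_algebra n) B \<subseteq> translates B UNIV"
proof -
  let ?R = "free_algebra n"
  let ?J = "carrier ?R \<inter> translates B UNIV"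
  interpret ring ?R by (rule ring_free_algebra)
  have mult: "p * f * q \<in> translates B UNIV" if "f \<in> translates B UNIV" for p f q
    using that by (rule translates_mult) simp
  have "ideal ?J ?R"
  proof (rule idealI[OF ring_axioms])
    show "subgroup ?J (add_monoid ?R)"
    proof (rule add.subgroupI)
      show "?J \<noteq> {}"
        using zero_closed translates.zero by force
      show "\<ominus>\<^bsub>?R\<^esub> f \<in> ?J" if "f \<in> ?J" for f
        using that a_inv_free_algebra[of f n] by (auto intro: translates_uminus)
      show "f \<oplus>\<^bsub>?R\<^esub> h \<in> ?J" if "f \<in> ?J" "h \<in> ?J" for f h
        using that add.m_closed[of f h] by (auto intro: translates_add)
    qed auto
    show "p \<otimes>\<^bsub>?R\<^esub> f \<in> ?J" if "f \<in> ?J" "p \<in> carrier ?R" for f p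
      using that m_closed[of p f] mult[of f p 1] by auto
    show "f \<otimes>\<^bsub>?R\<^esub> q \<in> ?J" if "f \<in> ?J" "q \<in> carrier ?R" for f q
      using that m_closed[of f q] mult[of f 1 q] by auto
  qed
  moreover have "B \<subseteq> ?J"
  proof
    fix g assume g: "g \<in> B"
    then have "1 * g * 1 \<in> translates B UNIV"
      by (rule translates_mult_generator) simp
    then show "g \<in> ?J"
      using g B by auto
  qed
  ultimately show ?thesis
    using genideal_minimal[of ?J B] by blast
qed


section \<open>Odd arity\<close>

lemma sum_of_squares_in_ideal:
  assumes "odd n"
  shows "2 * (\<Sum>b\<le>n. var (Suc b) * var (Suc b)) \<in>
    genideal (free_algebra n) (G n ` {1..n + 1} :: (word \<Rightarrow>\<^sub>0 'a::field) set)"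
proof -
  let ?R = "free_algebra n :: (word \<Rightarrow>\<^sub>0 'a) ring"
  let ?B = "G n ` {1..n + 1} :: (word \<Rightarrow>\<^sub>0 'a) set"
  let ?I = "genideal ?R ?B"
  interpret ring ?R by (rule ring_free_algebra)
  have B: "?B \<subseteq> carrier ?R"
    using G_in_free_algebra by blast
  interpret I: ideal ?I ?R by (rule genideal_ideal[OF B])
  have add: "f + h \<in> ?I" if "f \<in> ?I" "h \<in> ?I" for f h
    using I.a_closed[OF that] by simp
  have sign: "(- 1) ^ k * f \<in> ?I" if "f \<in> ?I" for f k
    using that I.a_inv_closed[OF that] a_inv_free_algebra[OF I.a_Hcarr[OF that]]
    by (cases "even k") simp_all
  have sum: "(\<Sum>b\<le>n. f b) \<in> ?I" if "\<And>b. b \<le> n \<Longrightarrow> f b \<in> ?I" for f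
  proof -
    have "(\<Sum>b\<in>A. f b) \<in> ?I" if "finite A" "A \<subseteq> {..n}" for A
      using that
    proof (induction A)
      case empty
      then show ?case using I.zero_closed by simp
    next
      case (insert b A)
      then show ?case using add \<open>\<And>b. b \<le> n \<Longrightarrow> f b \<in> ?I\<close> by simp
    qed
    then show ?thesis by simp
  qed
  have var: "var (Suc b) \<in> carrier ?R" if "b \<le> n" for b
    using that by (simp add: free_algebra_def var_def)
  have G: "G n (Suc b) \<in> ?I" if "b \<le> n" for b
    using genideal_self[OF B] that by auto
  have "var (Suc b) * G n (Suc b) \<in> ?I" "G n (Suc b) * var (Suc b) \<in> ?I" if "b \<le> n" for b
    using I.I_l_closed[OF G var, OF that that] I.I_r_closed[OF G var, OF that that] by simp_all
  then have "(\<Sum>b\<le>n. (- 1) ^ b * (var (Suc b) * G n (Suc b))) +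
      (\<Sum>b\<le>n. (- 1) ^ b * (G n (Suc b) * var (Suc b))) \<in> ?I"
    by (intro add sum sign)
  then have "(- 1) ^ (n div 2) * (2 * (\<Sum>b\<le>n. var (Suc b) * var (Suc b))) \<in> ?I"
    using relation_between_relations[of n, where 'a = 'a] assms by simp
  from sign[OF this, of "n div 2"] show ?thesis
    by (cases "even (n div 2)") simp_all
qed

lemma LM_sum_of_squares:
  fixes n :: nat
  defines "f \<equiv> 2 * (\<Sum>b\<le>n. var (Suc b) * var (Suc b)) :: word \<Rightarrow>\<^sub>0 'a::field"
  assumes "(2::'a) \<noteq> 0"
  shows "f \<noteq> 0" "length (letters (LM f)) = 2"
proof -
  have f: "f = (\<Sum>b\<le>n. Poly_Mapping.single (Word [Suc b, Suc b]) 2)"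
    by (simp add: f_def var_def mult_single plus_word_def sum_distrib_left flip: single_numeral)
  have "Poly_Mapping.lookup f (Word [1, 1]) = (\<Sum>b\<le>n. if b = 0 then 2 else 0)"
    unfolding f lookup_sum by (intro sum.cong) (auto simp: lookup_single when_def)
  then show "f \<noteq> 0"
    using assms by auto
  then have "LM f \<in> Poly_Mapping.keys f"
    by (rule LM_in_keys)
  then obtain b where "LM f \<in> Poly_Mapping.keys (Poly_Mapping.single (Word [Suc b, Suc b]) (2::'a))"
    using keys_sum[of "\<lambda>b. Poly_Mapping.single (Word [Suc b, Suc b]) (2::'a)" "{..n}"]
    unfolding f by blast
  then show "length (letters (LM f)) = 2"
    by (simp split: if_splits)
qed

theorem theorem4p1:
  fixes n :: nat
    and scale :: "'a::field \<Rightarrow> 'v::ab_group_add \<Rightarrow> 'v"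
    and L :: "'v set"
    and br :: "'v list \<Rightarrow> 'v"
    and e :: "nat \<Rightarrow> 'v"
  assumes "n \<ge> 3"
    and "(2::'a) \<noteq> 0"
    and "n_Lie_algebra scale n L br"
    and "n_Lie_algebra.simple scale n L br"
    and "inj_on e {1..n + 1}"
    and "\<not> module.dependent scale (e ` {1..n + 1})"
    and "module.span scale (e ` {1..n + 1}) = L"
    and "\<And>i. i \<in> {1..n + 1} \<Longrightarrow> br (omit n i e) = scale ((-1) ^ (n + i + 1)) (e i)"
  shows "groebner_basis (G n ` {1..n + 1})
           (genideal (free_algebra n) (G n ` {1..n + 1} :: (word \<Rightarrow>\<^sub>0 'a) set)) \<longleftrightarrow> even n"
proof -
  let ?B = "G n ` {1..n + 1} :: (word \<Rightarrow>\<^sub>0 'a) set"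
  let ?I = "genideal (free_algebra n) ?B"
  interpret ring "free_algebra n :: (word \<Rightarrow>\<^sub>0 'a) ring" by (rule ring_free_algebra)
  have n: "n \<ge> 2"
    using assms(1) by simp
  have B: "?B \<subseteq> carrier (free_algebra n)"
    using G_in_free_algebra by blast
  show ?thesis
  proof
    assume "even n"
    then interpret reduced_resolvable ?B
      by (rule reduced_resolvable_G[OF n])
    show "groebner_basis ?B ?I"
      unfolding groebner_basis_def
    proof (intro conjI ballI impI)
      show "?B \<subseteq> ?I"
        by (rule genideal_self[OF B])
      fix f assume "f \<in> ?I" "f \<noteq> 0"
      then obtain g where "g \<in> ?B" "factor (LM g) (LM f)"
        using diamond_lemma genideal_translates[OF B] by blast
      then show "\<exists>g\<in>?B. g \<noteq> 0 \<and> factor (LM g) (LM f)"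
        using monic monic_nonzero by blast
    qed
  next
    assume groebner: "groebner_basis ?B ?I"
    show "even n"
    proof (rule ccontr)
      assume "odd n"
      let ?f = "2 * (\<Sum>b\<le>n. var (Suc b) * var (Suc b)) :: word \<Rightarrow>\<^sub>0 'a"
      have f: "?f \<noteq> 0" "length (letters (LM ?f)) = 2"
        by (rule LM_sum_of_squares[OF assms(2)])+
      then obtain i where i: "i \<in> {1..n + 1}" "factor (LM (G n i :: word \<Rightarrow>\<^sub>0 'a)) (LM ?f)"
        using groebner sum_of_squares_in_ideal[OF \<open>odd n\<close>] unfolding groebner_basis_def by blast
      then have "n \<le> length (letters (LM ?f))"
        unfolding LM_G[OF n i(1)] factor_def by (auto simp: length_without)
      then show False
        using f(2) assms(1) by simp
    qed
  qed
qed

end
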